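(* There exists a skew left brace with multiplicative group isomorphic to $\mathbb{Z}$ and additive group isomorphic to the infinite dihedral group $\mathbb{D}_\infty=\langle r,s: srs=r^{-1},\ s^2=1\rangle$.
   Context: A skew left brace is a triple $(A,+,\circ)$ where $(A,+)$ and $(A,\circ)$ are (not necessarily abelian) groups such that $a\circ(b+c)=a\circ b-a+a\circ c$ for all $a,b,c\in A$. $(A,+)$ is called the additive group and $(A,\circ)$ the multiplicative group. *)

theory Defs
  imports "HOL-Algebra.Elementary_Groups"
begin

text \<open>
  A skew left brace on one carrier set. The record \<open>A\<close> is the additive group, written
  multiplicatively as is usual in HOL-Algebra (so \<open>b + c\<close> is \<open>b \<otimes>\<^bsub>A\<^esub> c\<close> and \<open>- a\<close> is
  \<open>inv\<^bsub>A\<^esub> a\<close>; it need not be abelian), and \<open>M\<close> is the multiplicative group.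
\<close>

locale skew_left_brace = additive: group A + multiplicative: group M
  for A :: "('a, 'b) monoid_scheme" and M :: "('a, 'c) monoid_scheme" +
  assumes same_carrier: "carrier M = carrier A"
    and brace_law: "\<lbrakk>a \<in> carrier A; b \<in> carrier A; c \<in> carrier A\<rbrakk> \<Longrightarrow>
      a \<otimes>\<^bsub>M\<^esub> (b \<otimes>\<^bsub>A\<^esub> c) = ((a \<otimes>\<^bsub>M\<^esub> b) \<otimes>\<^bsub>A\<^esub> inv\<^bsub>A\<^esub> a) \<otimes>\<^bsub>A\<^esub> (a \<otimes>\<^bsub>M\<^esub> c)"

text \<open>
  The generators are all elements of the type \<open>'g\<close>. A presentation is a set of pairs
  \<open>(u, v)\<close> of words, each standing for the relation \<open>u = v\<close>. The presented group is the
  quotient of the monoid of words by the least congruence that contains the relations and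
  makes \<open>Inv g\<close> a two-sided inverse of \<open>Gen g\<close>.
\<close>

datatype 'g letter = Gen 'g | Inv 'g

type_synonym 'g word = "'g letter list"

inductive word_eq :: "('g word \<times> 'g word) set \<Rightarrow> 'g word \<Rightarrow> 'g word \<Rightarrow> bool"
  for R where
  relation: "(u, v) \<in> R \<Longrightarrow> word_eq R u v"
| Gen_Inv: "word_eq R [Gen g, Inv g] []"
| Inv_Gen: "word_eq R [Inv g, Gen g] []"
| refl: "word_eq R u u"
| sym: "word_eq R u v \<Longrightarrow> word_eq R v u"
| trans: "word_eq R u v \<Longrightarrow> word_eq R v w \<Longrightarrow> word_eq R u w"
| append: "word_eq R u v \<Longrightarrow> word_eq R u' v' \<Longrightarrow> word_eq R (u @ u') (v @ v')"

definition word_rel :: "('g word \<times> 'g word) set \<Rightarrow> ('g word \<times> 'g word) set"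
  where "word_rel R = {(u, v). word_eq R u v}"

definition presented_group :: "('g word \<times> 'g word) set \<Rightarrow> 'g word set monoid"
  where "presented_group R =
    \<lparr>carrier = UNIV // word_rel R,
     monoid.mult = (\<lambda>P Q. \<Union>x\<in>P. \<Union>y\<in>Q. word_rel R `` {x @ y}),
     one = word_rel R `` {[]}\<rparr>"

lemma word_rel_iff: "(u, v) \<in> word_rel R \<longleftrightarrow> word_eq R u v"
  by (simp add: word_rel_def)

lemma equiv_word_rel: "equiv UNIV (word_rel R)"
  unfolding word_rel_def
  by (rule equivI) (auto simp: refl_on_def sym_def trans_def intro: word_eq.intros)

lemma word_class_eq_iff: "word_rel R `` {u} = word_rel R `` {v} \<longleftrightarrow> word_eq R u v"
  using eq_equiv_class_iff[OF equiv_word_rel, of u v R] by (simp add: word_rel_def)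

lemma presented_group_mult:
  "word_rel R `` {u} \<otimes>\<^bsub>presented_group R\<^esub> word_rel R `` {v} = word_rel R `` {u @ v}"
proof -
  have "congruent2 (word_rel R) (word_rel R) (\<lambda>x y. word_rel R `` {x @ y})"
    by (rule congruent2I')
      (simp add: word_class_eq_iff word_eq.append word_rel_iff)
  from UN_equiv_class2[OF equiv_word_rel equiv_word_rel this, of u v] show ?thesis
    by (simp add: presented_group_def)
qed

lemma word_left_inverse: "\<exists>v. word_eq R (v @ u) []"
proof (induction u)
  case Nil
  show ?case by (rule exI[of _ "[]"]) (simp add: word_eq.refl)
next
  case (Cons a u)
  then obtain v where v: "word_eq R (v @ u) []" by blast
  obtain b where b: "word_eq R [b, a] []"
    by (cases a) (auto intro: word_eq.Gen_Inv word_eq.Inv_Gen)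
  have "word_eq R (v @ [b, a] @ u) (v @ [] @ u)"
    by (intro word_eq.append word_eq.refl b)
  then have "word_eq R ((v @ [b]) @ a # u) []"
    using v by (auto intro: word_eq.trans)
  then show ?case by blast
qed

lemma group_presented_group: "group (presented_group R)"
proof -
  have carr: "carrier (presented_group R) = range (\<lambda>u. word_rel R `` {u})"
    by (auto simp: presented_group_def quotient_def)
  have one: "\<one>\<^bsub>presented_group R\<^esub> = word_rel R `` {[]}"
    by (simp add: presented_group_def)
  show ?thesis
  proof (rule groupI)
    fix P assume "P \<in> carrier (presented_group R)"
    then obtain u where P: "P = word_rel R `` {u}" by (auto simp: carr)
    obtain v where "word_eq R (v @ u) []" using word_left_inverse by blast
    then have "word_rel R `` {v} \<otimes>\<^bsub>presented_group R\<^esub> P = \<one>\<^bsub>presented_group R\<^esub>"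
      by (simp add: P one presented_group_mult word_class_eq_iff)
    then show "\<exists>Q\<in>carrier (presented_group R).
        Q \<otimes>\<^bsub>presented_group R\<^esub> P = \<one>\<^bsub>presented_group R\<^esub>"
      by (auto simp: carr)
  qed (auto simp: carr one presented_group_mult)
qed

datatype dihedral_gen = gen_r | gen_s

definition infinite_dihedral_group :: "dihedral_gen word set monoid"
  where "infinite_dihedral_group = presented_group
    {([Gen gen_s, Gen gen_r, Gen gen_s], [Inv gen_r]), ([Gen gen_s, Gen gen_s], [])}"

end

theory Submission
  imports Defs
begin

text \<open>
  In the infinite dihedral group the affine map with \<open>r\<^sup>i \<mapsto> r\<^sup>i s\<close> and \<open>r\<^sup>i s \<mapsto> r\<^bsup>i+1\<^esup>\<close> generates a
  regular cyclic subgroup of the holomorph. Numbering its orbit by the integers, \<open>r\<^sup>i = 2i\<close> and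
  \<open>r\<^sup>i s = 2i + 1\<close>, turns the multiplicative group into the integers under addition and the
  dihedral operation into \<open>a \<plusminus> b\<close>, with the sign determined by the parity of \<open>a\<close>.
\<close>

definition dihedral_int :: "int monoid"
  where "dihedral_int =
    \<lparr>carrier = UNIV, monoid.mult = (\<lambda>a b. if even a then a + b else a - b), one = 0\<rparr>"

lemma dihedral_int_simps [simp]:
  "carrier dihedral_int = UNIV"
  "a \<otimes>\<^bsub>dihedral_int\<^esub> b = (if even a then a + b else a - b)"
  "\<one>\<^bsub>dihedral_int\<^esub> = 0"
  by (simp_all add: dihedral_int_def)

text \<open>Associativity: \<open>a + b\<close> and \<open>a - b\<close> have the same parity, so
  the signs compose. Odd numbers are the reflections, hence their own inverses.\<close>

lemma group_dihedral_int: "group dihedral_int"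
proof (rule groupI)
  fix a assume "a \<in> carrier dihedral_int"
  have "(if even a then - a else a) \<otimes>\<^bsub>dihedral_int\<^esub> a = \<one>\<^bsub>dihedral_int\<^esub>" by simp
  then show "\<exists>b\<in>carrier dihedral_int. b \<otimes>\<^bsub>dihedral_int\<^esub> a = \<one>\<^bsub>dihedral_int\<^esub>"
    by (metis UNIV_I dihedral_int_simps(1))
qed auto

lemma inv_dihedral_int [simp]: "inv\<^bsub>dihedral_int\<^esub> a = (if even a then - a else a)"
  by (rule group.inv_equality[OF group_dihedral_int]) auto

text \<open>With \<open>a \<circ> b\<close> equal to \<open>a + b\<close>, the dihedral product of
  \<open>a + b\<close> with the inverse of \<open>a\<close> is \<open>b\<close> for even
  \<open>b\<close> and \<open>2 * a + b\<close> for odd \<open>b\<close>, whatever the parity of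
  \<open>a\<close>. Its product with \<open>a + c\<close> is then \<open>a + b + c\<close> or
  \<open>a + b - c\<close>, as the brace law demands.\<close>

lemma skew_left_brace_dihedral_int: "skew_left_brace dihedral_int integer_group"
proof -
  interpret A: group dihedral_int by (rule group_dihedral_int)
  interpret M: group integer_group by simp
  show ?thesis by unfold_locales (auto simp: integer_group_def)
qed

lemma dihedral_int_nat_pow: "(2::int) [^]\<^bsub>dihedral_int\<^esub> (n::nat) = 2 * int n"
  by (induction n) simp_all

lemma dihedral_int_int_pow: "(2::int) [^]\<^bsub>dihedral_int\<^esub> (i::int) = 2 * i"
  by (simp add: int_pow_def2 dihedral_int_nat_pow)

context group
begin

text \<open>Since \<open>s\<close> is an involution,
  \<open>x \<mapsto> s \<otimes> x \<otimes> s\<close> is an endomorphism. It inverts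
  \<open>r\<close>, hence every power of \<open>r\<close>; cancelling the right-hand
  \<open>s\<close> gives the claim.\<close>

lemma dihedral_conj_int_pow:
  fixes i :: int
  assumes [simp]: "r \<in> carrier G" "s \<in> carrier G"
    and srs: "s \<otimes> r \<otimes> s = inv r" and ss: "s \<otimes> s = \<one>"
  shows "s \<otimes> r [^] i = r [^] (- i) \<otimes> s"
proof -
  have cancel: "s \<otimes> (s \<otimes> x) = x" if "x \<in> carrier G" for x
    using that by (simp add: ss flip: m_assoc)
  have "(\<lambda>x. s \<otimes> x \<otimes> s) \<in> hom G G"
    by (rule homI) (simp_all add: m_assoc cancel)
  then interpret conj: group_hom G G "\<lambda>x. s \<otimes> x \<otimes> s"
    by unfold_locales
  have "s \<otimes> r [^] i \<otimes> s = r [^] (- i)"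
    using conj.hom_int_pow[of r i] by (simp add: srs int_pow_inv int_pow_neg)
  then show ?thesis
    by (metis assms(1,2) int_pow_closed m_assoc m_closed r_one ss)
qed

text \<open>The numbering read backwards, in any group satisfying the dihedral relations. An odd
  left factor ends in \<open>s\<close>, which inverts the power of \<open>r\<close> it passes: this
  is the minus sign in \<open>dihedral_int\<close>.\<close>

lemma hom_dihedral_int:
  assumes [simp]: "r \<in> carrier G" "s \<in> carrier G"
    and srs: "s \<otimes> r \<otimes> s = inv r" and ss: "s \<otimes> s = \<one>"
  shows "(\<lambda>n. r [^] (n div 2) \<otimes> (if even n then \<one> else s)) \<in> hom dihedral_int G"
    (is "?h \<in> _")
proof (rule homI)
  fix m n :: int
  note swap = dihedral_conj_int_pow[OF assms]
  have h: "?h (2 * i) = r [^] i" "?h (2 * i + 1) = r [^] i \<otimes> s" for i by simp_all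
  \<comment> \<open>Products get nested to the right by \<open>m_assoc\<close>, so moving
    \<open>s\<close> and merging powers must also work in front of a remaining factor
    \<open>x\<close>.\<close>
  have swap': "s \<otimes> (r [^] i \<otimes> x) = r [^] (- i) \<otimes> (s \<otimes> x)"
    if "x \<in> carrier G" for i :: int and x
    using that by (simp add: swap flip: m_assoc)
  have add: "r [^] i \<otimes> (r [^] j \<otimes> x) = r [^] (i + j) \<otimes> x"
    if "x \<in> carrier G" for i j :: int and x
    using that by (simp add: int_pow_mult m_assoc)
  have "m = 2 * (m div 2) \<or> m = 2 * (m div 2) + 1"
    and "n = 2 * (n div 2) \<or> n = 2 * (n div 2) + 1" by presburger+
  then obtain i j where ij: "m = 2 * i \<or> m = 2 * i + 1" "n = 2 * j \<or> n = 2 * j + 1" by blast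
  have "?h (m \<otimes>\<^bsub>dihedral_int\<^esub> n) = ?h m \<otimes> ?h n"
  proof (cases "even m")
    case True
    then have m: "m = 2 * i" using ij by auto
    consider "n = 2 * j" | "n = 2 * j + 1" using ij by blast
    then show ?thesis
    proof cases
      case 1
      have "m \<otimes>\<^bsub>dihedral_int\<^esub> n = 2 * (i + j)" by (simp add: m 1)
      then show ?thesis unfolding m 1 by (simp only: h) (simp add: int_pow_mult)
    next
      case 2
      have "m \<otimes>\<^bsub>dihedral_int\<^esub> n = 2 * (i + j) + 1" by (simp add: m 2)
      then show ?thesis unfolding m 2 by (simp only: h) (simp add: add)
    qed
  next
    case False
    then have m: "m = 2 * i + 1" using ij by auto
    consider "n = 2 * j" | "n = 2 * j + 1" using ij by blast
    then show ?thesis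
    proof cases
      case 1
      have "m \<otimes>\<^bsub>dihedral_int\<^esub> n = 2 * (i - j) + 1" by (simp add: m 1)
      then show ?thesis unfolding m 1 by (simp only: h) (simp add: m_assoc swap add)
    next
      case 2
      \<comment> \<open>The two odd units cancel, matching \<open>s \<otimes> s = \<one>\<close> on
        the group side.\<close>
      have "m \<otimes>\<^bsub>dihedral_int\<^esub> n = 2 * (i - j)" by (simp add: m 2)
      then show ?thesis unfolding m 2
        by (simp only: h) (simp add: m_assoc swap' ss flip: int_pow_mult)
    qed
  qed
  then show "?h (m \<otimes>\<^bsub>dihedral_int\<^esub> n) = ?h m \<otimes> ?h n" .
qed simp

end

lemma carrier_presented_group:
  "carrier (presented_group R) = range (\<lambda>u. word_rel R `` {u})"
  by (auto simp: presented_group_def quotient_def)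

lemma one_presented_group: "\<one>\<^bsub>presented_group R\<^esub> = word_rel R `` {[]}"
  by (simp add: presented_group_def)

lemma inv_presented_group_Gen:
  "inv\<^bsub>presented_group R\<^esub> (word_rel R `` {[Gen g]}) = word_rel R `` {[Inv g]}"
  by (rule group.inv_equality[OF group_presented_group])
    (auto simp: carrier_presented_group one_presented_group presented_group_mult
      word_class_eq_iff intro: word_eq.Inv_Gen)

text \<open>\<open>H\<close> also contains the inverses of the generators, hence the class of every
  letter, and each word class is a product of these.\<close>

lemma subgroup_presented_group_eq_carrier:
  assumes "subgroup H (presented_group R)" and gens: "\<And>g. word_rel R `` {[Gen g]} \<in> H"
  shows "H = carrier (presented_group R)"
proof -
  interpret subgroup H "presented_group R" by fact
  have letter: "word_rel R `` {[a]} \<in> H" for a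
    by (cases a) (use gens m_inv_closed in \<open>auto simp flip: inv_presented_group_Gen\<close>)
  have "word_rel R `` {u} \<in> H" for u
  proof (induction u)
    case Nil
    show ?case using one_closed by (simp add: one_presented_group)
  next
    case (Cons a u)
    then show ?case
      using m_closed[OF letter[of a] Cons] by (simp add: presented_group_mult)
  qed
  then show ?thesis using subset by (auto simp: carrier_presented_group)
qed

fun letter_value :: "('a, 'b) monoid_scheme \<Rightarrow> ('g \<Rightarrow> 'a) \<Rightarrow> 'g letter \<Rightarrow> 'a"
  where
    "letter_value G f (Gen g) = f g"
  | "letter_value G f (Inv g) = inv\<^bsub>G\<^esub> (f g)"

definition word_value :: "('a, 'b) monoid_scheme \<Rightarrow> ('g \<Rightarrow> 'a) \<Rightarrow> 'g word \<Rightarrow> 'a"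
  where "word_value G f u = foldr (\<lambda>a x. letter_value G f a \<otimes>\<^bsub>G\<^esub> x) u \<one>\<^bsub>G\<^esub>"

lemma word_value_simps [simp]:
  "word_value G f [] = \<one>\<^bsub>G\<^esub>"
  "word_value G f (a # u) = letter_value G f a \<otimes>\<^bsub>G\<^esub> word_value G f u"
  by (simp_all add: word_value_def)

context group
begin

lemma letter_value_closed [simp]: "range f \<subseteq> carrier G \<Longrightarrow> letter_value G f a \<in> carrier G"
  by (cases a) auto

lemma word_value_closed [simp]: "range f \<subseteq> carrier G \<Longrightarrow> word_value G f u \<in> carrier G"
  by (induction u) simp_all

lemma word_value_append:
  "range f \<subseteq> carrier G \<Longrightarrow> word_value G f (u @ v) = word_value G f u \<otimes> word_value G f v"
  by (induction u) (simp_all add: m_assoc)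

text \<open>Having equal values is itself a congruence that satisfies the relations and the inverse
  laws, and \<open>word_eq R\<close> is the least one.\<close>

lemma word_value_cong:
  assumes f: "range f \<subseteq> carrier G"
    and rels: "\<And>u v. (u, v) \<in> R \<Longrightarrow> word_value G f u = word_value G f v"
    and "word_eq R u v"
  shows "word_value G f u = word_value G f v"
  using \<open>word_eq R u v\<close>
proof induction
  case (Gen_Inv g)
  have "f g \<in> carrier G" using f by auto
  then show ?case by simp
next
  case (Inv_Gen g)
  have "f g \<in> carrier G" using f by auto
  then show ?case by simp
qed (simp_all add: rels word_value_append f)

text \<open>The universal property of a presentation (von Dyck's theorem).\<close>

lemma presented_group_hom_exists:
  assumes f: "range f \<subseteq> carrier G"
    and rels: "\<And>u v. (u, v) \<in> R \<Longrightarrow> word_value G f u = word_value G f v"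
  obtains \<phi> where "\<phi> \<in> hom (presented_group R) G" "\<And>g. \<phi> (word_rel R `` {[Gen g]}) = f g"
proof
  \<comment> \<open>Evaluation is constant on each class, so the image of a class is a singleton and
    \<open>the_elem\<close> extracts its value.\<close>
  let ?\<phi> = "\<lambda>P. the_elem (word_value G f ` P)"
  have \<phi>: "?\<phi> (word_rel R `` {u}) = word_value G f u" for u
  proof -
    have "word_value G f v = word_value G f u" if "word_eq R u v" for v
      using word_value_cong[of f R u v] f rels that by simp
    then have "word_value G f ` (word_rel R `` {u}) = {word_value G f u}"
      by (auto simp: word_rel_iff intro!: image_eqI[of _ _ u] word_eq.refl)
    then show ?thesis by simp
  qed
  show "?\<phi> \<in> hom (presented_group R) G"
    by (rule homI)
      (auto simp: carrier_presented_group presented_group_mult \<phi> f word_value_append)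
  show "?\<phi> (word_rel R `` {[Gen g]}) = f g" for g
  proof -
    have "f g \<in> carrier G" using f by auto
    then show ?thesis by (simp add: \<phi>)
  qed
qed

end

text \<open>The map \<open>h\<close> is onto because its range is a subgroup containing both
  generators. It is injective because the universal property supplies a left inverse
  \<open>\<phi>\<close>, which rules out any further collapse in the presented group.\<close>

lemma dihedral_int_iso: "dihedral_int \<cong> infinite_dihedral_group"
proof -
  define R where
    "R = {([Gen gen_s, Gen gen_r, Gen gen_s], [Inv gen_r]), ([Gen gen_s, Gen gen_s], [])}"
  define D where "D = presented_group R"
  define r where "r = word_rel R `` {[Gen gen_r]}"
  define s where "s = word_rel R `` {[Gen gen_s]}"
  define h where "h n = r [^]\<^bsub>D\<^esub> (n div 2) \<otimes>\<^bsub>D\<^esub> (if even n then \<one>\<^bsub>D\<^esub> else s)" for n :: int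
  interpret D: group D unfolding D_def by (rule group_presented_group)
  interpret A: group dihedral_int by (rule group_dihedral_int)
  have rs [simp]: "r \<in> carrier D" "s \<in> carrier D"
    by (auto simp: D_def r_def s_def carrier_presented_group)
  have "s \<otimes>\<^bsub>D\<^esub> r \<otimes>\<^bsub>D\<^esub> s = inv\<^bsub>D\<^esub> r" "s \<otimes>\<^bsub>D\<^esub> s = \<one>\<^bsub>D\<^esub>"
    by (auto simp: D_def r_def s_def presented_group_mult inv_presented_group_Gen
        one_presented_group word_class_eq_iff R_def intro: word_eq.relation)
  then have h_hom: "h \<in> hom dihedral_int D"
    unfolding h_def using D.hom_dihedral_int[OF rs] by simp
  then interpret h: group_hom dihedral_int D h by unfold_locales
  \<comment> \<open>The numbers of \<open>r\<close> and \<open>s\<close> in the numbering.\<close>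
  define f where "f = case_dihedral_gen (2::int) 1"
  obtain \<phi> where \<phi>: "\<phi> \<in> hom D dihedral_int" "\<And>g. \<phi> (word_rel R `` {[Gen g]}) = f g"
    unfolding D_def
  proof (rule A.presented_group_hom_exists[of f R])
    \<comment> \<open>The relations hold in \<open>dihedral_int\<close>: the product of 1, 2, 1 is
      -2, the inverse of 2, and that of 1, 1 is 0.\<close>
    show "word_value dihedral_int f u = word_value dihedral_int f v" if "(u, v) \<in> R" for u v
      using that by (auto simp: R_def f_def)
  qed auto
  interpret \<phi>: group_hom D dihedral_int \<phi> using \<phi>(1) by unfold_locales
  have "\<phi> r = 2" "\<phi> s = 1" by (simp_all add: r_def s_def \<phi>(2) f_def)
  \<comment> \<open>The power of \<open>r\<close> contributes the even number
    \<open>2 * (n div 2)\<close>, so the sign is plus, and the last factor adds the remainder 0 or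
    1.\<close>
  then have "\<phi> (h n) = n" for n
    by (simp add: h_def \<phi>.hom_int_pow dihedral_int_int_pow del: dihedral_int_simps(1))
  then have "inj h" by (metis injI)
  have "word_rel R `` {[Gen g]} \<in> range h" for g
  proof (cases g)
    case gen_r
    have "h 2 = r" by (simp add: h_def)
    then show ?thesis unfolding gen_r r_def by (metis rangeI)
  next
    case gen_s
    have "h 1 = s" by (simp add: h_def)
    then show ?thesis unfolding gen_s s_def by (metis rangeI)
  qed
  then have "range h = carrier D"
    using h.img_is_subgroup subgroup_presented_group_eq_carrier[of "range h" R]
    by (simp add: D_def)
  with \<open>inj h\<close> h_hom have "h \<in> iso dihedral_int D"
    by (simp add: iso_def bij_betw_def)
  then show ?thesis
    unfolding D_def R_def infinite_dihedral_group_def by (rule is_isoI)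
qed

theorem theorem5p8:
  shows "\<exists>(A :: int monoid) (M :: int monoid).
    skew_left_brace A M \<and> M \<cong> integer_group \<and> A \<cong> infinite_dihedral_group"
  using skew_left_brace_dihedral_int dihedral_int_iso iso_refl by blast

end
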